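(* Assume that the linear two point boundary-value problem $$\dot{x}(t)-A(t)x(t)=r(t),\quad t\in[a,b],\qquad B_a x(a)+B_b x(b)=\beta$$ has a unique solution. Let $X_j$, $M$, $q$, $L$, $U$, $V$, $\mathcal{U}=UV^\top$ and $\mathcal{M}=M-\mathcal{U}$ be the matrices and vectors defined in the context from this problem and the shooting points $a=\tau_0<\tau_1<\cdots<\tau_m=b$, $m\ge 2$. Then: (1) $\mathcal{M}$ is invertible. (2) $V^\top\mathcal{M}^{-1}U=0$, so that $I_n+V^\top\mathcal{M}^{-1}U=I_n$ is invertible (hence the Sherman-Morrison-Woodbury formula can be applied to $M=\mathcal{M}+UV^\top$). (3) The solution $c\in\mathbb{R}^{mn}$ of the linear system $Mc=q$ is $$c=M^{-1}q=\mathcal{M}^{-1}q-\mathcal{M}^{-1}\,\mathcal{U}\,\mathcal{M}^{-1}q .$$ Equivalently, $c=\xi-\zeta$, where $\xi$ is the solution of $\mathcal{M}\xi=q$ and $\zeta$ is the solution of $\mathcal{M}\zeta=\mathcal{U}\xi$.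
   Context: Let $n\ge 1$, $m\ge 2$, $a<b$ be given, let $A:[a,b]\to\mathbb{R}^{n\times n}$ and $r:[a,b]\to\mathbb{R}^n$ be continuous, $B_a,B_b\in\mathbb{R}^{n\times n}$ and $\beta\in\mathbb{R}^n$. Let $a=\tau_0<\tau_1<\cdots<\tau_{m-1}<\tau_m=b$ be the shooting points. For $j=0,\dots,m-1$ let $X(\cdot;\tau_j)$ be the matrix-valued solution of $\dot X(t;\tau_j)=A(t)X(t;\tau_j)$ on $[\tau_j,\tau_{j+1}]$ with $X(\tau_j;\tau_j)=I_n$, and let $v(\cdot;\tau_j)$ be the solution of $\dot v(t;\tau_j)=A(t)v(t;\tau_j)+r(t)$ on $[\tau_j,\tau_{j+1}]$ with $v(\tau_j;\tau_j)=0$. Put $X_j:=X(\tau_{j+1};\tau_j)\in\mathbb{R}^{n\times n}$ (an invertible matrix), $v_j:=v(\tau_{j+1};\tau_j)\in\mathbb{R}^n$ and $Y_j:=-X_j$. All block matrices below consist of $n\times n$ blocks, with $m$ block rows and/or block columns as applicable; blank entries are zero. The standard multiple shooting system (continuity and boundary conditions) is $Mc=q$ with $$M=\begin{bmatrix} Y_0 & I_n\\ & Y_1 & I_n\\ &&\ddots&\ddots\\ &&& Y_{m-2}& I_n\\ B_a &&&& B_bX_{m-1}\end{bmatrix}\in\mathbb{R}^{mn\times mn},\qquad q=\begin{pmatrix} v_0\\ \vdots\\ v_{m-2}\\ \beta-B_bv_{m-1}\end{pmatrix}\in\mathbb{R}^{mn}.$$ (For $m=2$ this means $M=\begin{bmatrix}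 Y_0 & I_n \\ B_a & B_bX_1\end{bmatrix}$.) Define $L:=X_0^{-1}X_1^{-1}\cdots X_{m-2}^{-1}$, and $U,V\in\mathbb{R}^{mn\times n}$ by $$U=[0,\dots,0,B_a^\top]^\top,\qquad V^\top=[I_n,0,\dots,0,-L].$$ Then $\mathcal{U}:=UV^\top$ has only two possibly nonzero blocks, both in the last block row: $B_a$ in the first block column and $-B_aL$ in the last block column. Consequently $$\mathcal{M}:=M-\mathcal{U}=\begin{bmatrix} Y_0 & I_n\\ & Y_1 & I_n\\ &&\ddots&\ddots\\ &&& Y_{m-2}& I_n\\ &&&& \mathcal{B}\end{bmatrix},\qquad \mathcal{B}:=B_bX_{m-1}+B_aL .$$ The Sherman-Morrison-Woodbury formula states: if $P\in\mathbb{R}^{\ell\times\ell}$ is invertible, $U,V\in\mathbb{R}^{\ell\times p}$, and $I_p+V^\top P^{-1}U$ is invertible, then $(P+UV^\top)^{-1}=P^{-1}-P^{-1}U(I_p+V^\top P^{-1}U)^{-1}V^\top P^{-1}$. Known background fact: if the boundary-value problem has a unique solution, then $M$ is invertible and $N:=B_a+B_bX(b;a)$ is invertible, where $X(\cdot;a)$ is extended to $[a,b]$ as the solution of $\dot X=AX$, $X(a;a)=I_n$. *)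

theory Defs
  imports "HOL-Analysis.Analysis"
begin

(* The space R^(m n), split into m blocks of length n, is real ^ ('m \<times> 'n) with m = CARD('m) and
   n = CARD('n): the coordinate (i, k) is entry k of the block with index i. The linear order
   of 'm numbers the blocks 0, ..., m - 1. *)

definition block_pos :: "'m::{finite,linorder} \<Rightarrow> nat" where
  "block_pos i = card {..<i}"

lemma bij_betw_block_pos:
  "bij_betw (block_pos :: 'm::{finite,linorder} \<Rightarrow> nat) UNIV {..<CARD('m)}"
proof -
  have less: "block_pos i < block_pos j" if "i < j" for i j :: 'm
    unfolding block_pos_def using that by (intro psubset_card_mono) auto
  have inj: "inj (block_pos :: 'm \<Rightarrow> nat)"
    by (rule injI) (metis less less_irrefl neqE)
  have "block_pos i < CARD('m)" for i :: 'm
    unfolding block_pos_def by (intro psubset_card_mono) auto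
  then have "range (block_pos :: 'm \<Rightarrow> nat) \<subseteq> {..<CARD('m)}"
    by auto
  moreover have "card (range (block_pos :: 'm \<Rightarrow> nat)) = card {..<CARD('m)}"
    using inj by (simp add: card_image)
  ultimately have "range (block_pos :: 'm \<Rightarrow> nat) = {..<CARD('m)}"
    by (intro card_subset_eq) simp_all
  with inj show ?thesis
    by (simp add: bij_betw_def)
qed

definition block_matrix ::
  "(nat \<Rightarrow> nat \<Rightarrow> real^'n^'n) \<Rightarrow> real^('m::{finite,linorder} \<times> 'n::finite)^('m \<times> 'n)" where
  "block_matrix F = (\<chi> p q. F (block_pos (fst p)) (block_pos (fst q)) $ snd p $ snd q)"

definition block_column ::
  "(nat \<Rightarrow> real^'n^'n) \<Rightarrow> real^'n^('m::{finite,linorder} \<times> 'n::finite)" where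
  "block_column F = (\<chi> p l. F (block_pos (fst p)) $ snd p $ l)"

definition block_row ::
  "(nat \<Rightarrow> real^'n^'n) \<Rightarrow> real^('m::{finite,linorder} \<times> 'n::finite)^'n" where
  "block_row F = (\<chi> k q. F (block_pos (fst q)) $ k $ snd q)"

definition block_vector ::
  "(nat \<Rightarrow> real^'n) \<Rightarrow> real^('m::{finite,linorder} \<times> 'n::finite)" where
  "block_vector f = (\<chi> p. f (block_pos (fst p)) $ snd p)"

definition bvp_solution ::
  "(real \<Rightarrow> real^'n^'n) \<Rightarrow> (real \<Rightarrow> real^'n) \<Rightarrow> real \<Rightarrow> real \<Rightarrow>
   real^'n^'n \<Rightarrow> real^'n^'n \<Rightarrow> real^'n \<Rightarrow> (real \<Rightarrow> real^'n::finite) \<Rightarrow> bool" where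
  "bvp_solution A r a b Ba Bb \<beta> x \<longleftrightarrow>
     (\<forall>t\<in>{a..b}. (x has_vector_derivative A t *v x t + r t) (at t within {a..b})) \<and>
     Ba *v x a + Bb *v x b = \<beta>"

(* HOL functions are total, so uniqueness can only be asked for on {a..b}. *)
definition bvp_uniquely_solvable ::
  "(real \<Rightarrow> real^'n^'n) \<Rightarrow> (real \<Rightarrow> real^'n) \<Rightarrow> real \<Rightarrow> real \<Rightarrow>
   real^'n^'n \<Rightarrow> real^'n^'n \<Rightarrow> real^'n::finite \<Rightarrow> bool" where
  "bvp_uniquely_solvable A r a b Ba Bb \<beta> \<longleftrightarrow>
     (\<exists>x. bvp_solution A r a b Ba Bb \<beta> x \<and>
          (\<forall>y. bvp_solution A r a b Ba Bb \<beta> y \<longrightarrow> (\<forall>t\<in>{a..b}. y t = x t)))"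

(* Below, X j and v j are the values at the right end of the j-th shooting interval. *)

definition shooting_matrix ::
  "real^'n^'n \<Rightarrow> real^'n^'n \<Rightarrow> (nat \<Rightarrow> real^'n^'n) \<Rightarrow>
   real^('m::{finite,linorder} \<times> 'n::finite)^('m \<times> 'n)" where
  "shooting_matrix Ba Bb X = block_matrix (\<lambda>i j.
     if i < CARD('m) - 1
     then (if j = i then - X i else if j = i + 1 then mat 1 else 0)
     else (if j = 0 then Ba else if j = CARD('m) - 1 then Bb ** X (CARD('m) - 1) else 0))"

definition shooting_rhs ::
  "real^'n^'n \<Rightarrow> real^'n \<Rightarrow> (nat \<Rightarrow> real^'n) \<Rightarrow>
   real^('m::{finite,linorder} \<times> 'n::finite)" where
  "shooting_rhs Bb \<beta> v = block_vector (\<lambda>i.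
     if i < CARD('m) - 1 then v i else \<beta> - Bb *v v (CARD('m) - 1))"

primrec inverse_product :: "(nat \<Rightarrow> real^'n^'n) \<Rightarrow> nat \<Rightarrow> real^'n^'n::finite" where
  "inverse_product X 0 = mat 1"
| "inverse_product X (Suc k) = inverse_product X k ** matrix_inv (X k)"

definition shooting_U ::
  "real^'n^'n \<Rightarrow> real^'n^('m::{finite,linorder} \<times> 'n::finite)" where
  "shooting_U Ba = block_column (\<lambda>i. if i = CARD('m) - 1 then Ba else 0)"

definition shooting_V ::
  "real^'n^'n \<Rightarrow> real^'n^('m::{finite,linorder} \<times> 'n::finite)" where
  "shooting_V L = transpose (block_row (\<lambda>j.
     if j = 0 then mat 1 else if j = CARD('m) - 1 then - L else 0))"

end

theory Submission
  imports Defs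
begin

text \<open>
  Everything rests on one observation about \<open>M0 = M - U V\<^sup>T\<close>: the first \<open>m - 1\<close> block rows of
  \<open>M0\<close> are those of \<open>M\<close>, because \<open>U\<close> lives in the last block row. If these rows annihilate a
  block vector \<open>c\<close>, then \<open>c\<close> obeys the continuity recurrence \<open>c\<^sub>i\<^sub>+\<^sub>1 = X\<^sub>i c\<^sub>i\<close>. Undoing the
  recurrence with the inverses collected in \<open>L\<close> gives \<open>c\<^sub>0 = L c\<^sub>m\<^sub>-\<^sub>1\<close>, which says exactly
  \<open>V\<^sup>T c = 0\<close> (lemma \<open>shooting_V_mult_eq_0\<close>). So the correction \<open>U V\<^sup>T\<close> is invisible on such vectors.

  Two consequences follow. First, a kernel vector of \<open>M0\<close> is a kernel vector of \<open>M\<close>. Its blocks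
  are initial values of homogeneous solutions on the shooting intervals that match at the
  shooting points, so they glue to one solution of the homogeneous differential equation on
  \<open>[a,b]\<close> (lemma \<open>glue_solutions\<close>), and the last row of \<open>M\<close> is its homogeneous boundary condition.
  Unique solvability forces this solution to vanish (lemma \<open>bvp_homogeneous_solution_zero\<close>), hence
  \<open>M0\<close> is injective. Second, \<open>w = M0\<inverse> U d\<close> satisfies \<open>M0 w = U d\<close>, whose first \<open>m - 1\<close> blocks are
  zero; therefore \<open>V\<^sup>T M0\<inverse> U d = V\<^sup>T w = 0\<close>.

  With \<open>V\<^sup>T M0\<inverse> U = 0\<close> the Sherman-Morrison-Woodbury formula collapses to
  \<open>M\<inverse> = M0\<inverse> - M0\<inverse> U V\<^sup>T M0\<inverse>\<close> (lemma \<open>woodbury_trivial_capacitance\<close>), from which the invertibility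
  of \<open>M\<close> and all statements on \<open>c\<close>, \<open>\<xi>\<close> and \<open>\<zeta>\<close> are read off.

  The invertibility of the \<open>X\<^sub>i\<close>, which gives \<open>L\<close> its meaning, is itself an injectivity statement: a
  solution of a homogeneous linear system that vanishes at the right end of an interval vanishes
  at the left end (lemma \<open>linear_ode_zero_at_left_end\<close>).
\<close>

section \<open>Backward uniqueness for homogeneous linear systems\<close>

lemma bounded_linear_matrix_vector_mult_left:
  "bounded_linear (\<lambda>P :: real^'n::finite^'k::finite. P *v z)"
proof -
  have "linear (\<lambda>P :: real^'n^'k. P *v z)"
    by (rule linearI) (simp_all add: matrix_vector_mult_add_rdistrib scaleR_matrix_vector_assoc)
  then show ?thesis
    by (simp add: linear_conv_bounded_linear)
qed

text \<open>
  A Gronwall argument run backwards: if \<open>K\<close> bounds the operator norms of \<open>A t\<close>, then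
  \<open>\<bar>(y \<bullet> y)'\<bar> \<le> 2 K (y \<bullet> y)\<close>, so \<open>(y \<bullet> y) exp (2 K t)\<close> is nondecreasing. It is nonnegative, and zero at
  the right end.
\<close>

lemma linear_ode_zero_at_left_end:
  fixes A :: "real \<Rightarrow> real^'n::finite^'n" and y :: "real \<Rightarrow> real^'n"
  assumes "s \<le> e" and contA: "continuous_on {s..e} A"
    and y: "\<And>t. t \<in> {s..e} \<Longrightarrow> (y has_vector_derivative A t *v y t) (at t within {s..e})"
    and "y e = 0"
  shows "y s = 0"
proof -
  obtain C where C: "\<And>t. t \<in> {s..e} \<Longrightarrow> norm (A t) \<le> C"
    using compact_imp_bounded[OF compact_continuous_image[OF contA compact_Icc]]
    unfolding bounded_iff by blast
  \<comment> \<open>The dimension factors pass from a bound on the entries of \<open>A t\<close> to one on its operator norm.\<close>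
  define K where "K = real CARD('n) * real CARD('n) * C"
  have growth: "\<bar>y t \<bullet> (A t *v y t)\<bar> \<le> K * (y t \<bullet> y t)" if "t \<in> {s..e}" for t
  proof -
    have "\<bar>A t $ i $ j\<bar> \<le> C" for i j
      by (meson C Finite_Cartesian_Product.norm_nth_le component_le_norm_cart order_trans that)
    then have "onorm ((*v) (A t)) \<le> K"
      unfolding K_def by (rule onorm_le_matrix_component)
    then have "norm (A t *v y t) \<le> K * norm (y t)"
      by (meson matrix_vector_mul_bounded_linear mult_right_mono norm_ge_zero onorm order_trans)
    then have "norm (y t) * norm (A t *v y t) \<le> norm (y t) * (K * norm (y t))"
      by (simp add: mult_left_mono)
    with Cauchy_Schwarz_ineq2[of "y t" "A t *v y t"] show ?thesis
      by (simp add: dot_square_norm power2_eq_square mult.commute mult.left_commute)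
  qed
  define \<phi> where "\<phi> t = (y t \<bullet> y t) * exp (2 * K * t)" for t
  have conty: "continuous_on {s..e} y"
    unfolding continuous_on_eq_continuous_within
    using y has_vector_derivative_continuous by blast
  have "\<phi> s \<le> \<phi> e"
  proof (rule DERIV_nonneg_imp_increasing_open[OF \<open>s \<le> e\<close>])
    fix t assume t: "s < t" "t < e"
    then have "(y has_vector_derivative A t *v y t) (at t)"
      using y[of t] at_within_Icc_at[of s t e] by simp
    then have "((\<lambda>t. y t \<bullet> y t) has_real_derivative 2 * (y t \<bullet> (A t *v y t))) (at t)"
      unfolding has_vector_derivative_def has_field_derivative_def
      by (auto intro!: derivative_eq_intros simp: inner_commute algebra_simps)
    then have "(\<phi> has_real_derivative
        2 * (y t \<bullet> (A t *v y t)) * exp (2 * K * t)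
        + (y t \<bullet> y t) * (exp (2 * K * t) * (2 * K))) (at t)"
      unfolding \<phi>_def by (auto intro!: derivative_eq_intros)
    moreover have "0 \<le> 2 * (y t \<bullet> (A t *v y t) + K * (y t \<bullet> y t)) * exp (2 * K * t)"
      using growth[of t] t by (intro mult_nonneg_nonneg) auto
    ultimately show "\<exists>d. DERIV \<phi> t :> d \<and> 0 \<le> d"
      by (intro exI conjI) (auto simp: algebra_simps)
  next
    show "continuous_on {s..e} \<phi>"
      unfolding \<phi>_def by (intro continuous_intros conty)
  qed
  then have "y s \<bullet> y s \<le> 0"
    using \<open>y e = 0\<close> by (simp add: \<phi>_def mult_le_0_iff)
  then show ?thesis
    using inner_ge_zero[of "y s"] by (simp add: antisym)
qed

lemma invertible_iff_trivial_kernel: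
  fixes P :: "real^'k::finite^'k"
  shows "invertible P \<longleftrightarrow> (\<forall>x. P *v x = 0 \<longrightarrow> x = 0)"
  by (simp add: invertible_left_inverse matrix_left_invertible_ker)

lemma has_vector_derivative_matrix_solution_mult:
  fixes A X :: "real \<Rightarrow> real^'n::finite^'n"
  assumes "(X has_vector_derivative A t ** X t) (at t within S)"
  shows "((\<lambda>t. X t *v z) has_vector_derivative A t *v (X t *v z)) (at t within S)"
  using bounded_linear.has_vector_derivative[OF bounded_linear_matrix_vector_mult_left assms, of z]
  by (simp add: matrix_vector_mul_assoc)

lemma fundamental_matrix_invertible:
  fixes A X :: "real \<Rightarrow> real^'n::finite^'n"
  assumes "s \<le> e" and "continuous_on {s..e} A" and "X s = mat 1"
    and "\<And>t. t \<in> {s..e} \<Longrightarrow> (X has_vector_derivative A t ** X t) (at t within {s..e})"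
  shows "invertible (X e)"
  unfolding invertible_iff_trivial_kernel
proof (intro allI impI)
  fix z assume "X e *v z = 0"
  then have "X s *v z = 0"
    using linear_ode_zero_at_left_end[where y = "\<lambda>t. X t *v z" and A = A and s = s and e = e]
      assms has_vector_derivative_matrix_solution_mult[where X = X and A = A and z = z]
    by blast
  then show "z = 0"
    using \<open>X s = mat 1\<close> by simp
qed

section \<open>Gluing solutions over the shooting intervals\<close>

text \<open>
  At the joint \<open>u\<close> the glued function is differentiable because both one-sided derivatives are given
  by the same right-hand side \<open>F u\<close> at the same value \<open>y u = z u\<close>, so they agree.
\<close>

lemma has_vector_derivative_glue_Icc:
  fixes y z :: "real \<Rightarrow> 'a::real_normed_vector"
  assumes "s \<le> u" "u \<le> e" and "t \<in> {s..e}"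
    and y: "\<And>t. t \<in> {s..u} \<Longrightarrow> (y has_vector_derivative F t (y t)) (at t within {s..u})"
    and z: "\<And>t. t \<in> {u..e} \<Longrightarrow> (z has_vector_derivative F t (z t)) (at t within {u..e})"
    and "y u = z u"
  defines "w \<equiv> \<lambda>t. if t \<in> {s..u} then y t else z t"
  shows "(w has_vector_derivative F t (w t)) (at t within {s..e})"
proof -
  have closures: "closure {s..u} \<inter> closure {u..e} = {u}" "{s..u} \<union> {u} = {s..u}"
      "{u..e} \<union> {u} = {u..e}"
    using assms(1,2) by auto
  have "(w has_vector_derivative (if t \<in> {s..u} then F t (y t) else F t (z t)))
      (at t within {s..e})"
    unfolding w_def
  proof (rule has_vector_derivative_If_within_closures[where T = "{u..e}"])
    show "t \<in> {s..u} \<union> {u..e}" "{s..e} = {s..u} \<union> {u..e}"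
      using assms(1-3) by auto
    assume "t \<in> closure {s..u}" "t \<in> closure {u..e}"
    then have "t = u" by simp
    then show "y t = z t" "F t (y t) = F t (z t)"
      using \<open>y u = z u\<close> by simp_all
  qed (use y z closures in auto)
  then show ?thesis
    by (simp add: w_def if_distrib[of "F t"])
qed

text \<open>
  The \<open>Suc k\<close> intervals are numbered \<open>0, \<dots>, k\<close>. The conclusion \<open>\<tau> 0 < \<tau> (Suc k)\<close> is carried
  along because it tells, in the induction step, which of the two pieces supplies each boundary value.
\<close>

lemma glue_solutions:
  fixes y :: "nat \<Rightarrow> real \<Rightarrow> 'a::real_normed_vector" and \<tau> :: "nat \<Rightarrow> real"
  assumes "\<And>j. j \<le> k \<Longrightarrow> \<tau> j < \<tau> (Suc j)"
    and "\<And>j t. j \<le> k \<Longrightarrow> t \<in> {\<tau> j..\<tau> (Suc j)} \<Longrightarrow>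
           (y j has_vector_derivative F t (y j t)) (at t within {\<tau> j..\<tau> (Suc j)})"
    and "\<And>j. j < k \<Longrightarrow> y j (\<tau> (Suc j)) = y (Suc j) (\<tau> (Suc j))"
  shows "\<exists>z. (\<forall>t\<in>{\<tau> 0..\<tau> (Suc k)}.
            (z has_vector_derivative F t (z t)) (at t within {\<tau> 0..\<tau> (Suc k)}))
          \<and> z (\<tau> 0) = y 0 (\<tau> 0) \<and> z (\<tau> (Suc k)) = y k (\<tau> (Suc k)) \<and> \<tau> 0 < \<tau> (Suc k)"
  using assms
proof (induction k)
  case 0
  then show ?case by (intro exI[of _ "y 0"]) auto
next
  case (Suc k)
  from Suc.IH obtain z where z: "\<And>t. t \<in> {\<tau> 0..\<tau> (Suc k)} \<Longrightarrow>
        (z has_vector_derivative F t (z t)) (at t within {\<tau> 0..\<tau> (Suc k)})"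
      "z (\<tau> 0) = y 0 (\<tau> 0)" "z (\<tau> (Suc k)) = y k (\<tau> (Suc k))" "\<tau> 0 < \<tau> (Suc k)"
    using Suc.prems by (metis le_SucI less_SucI)
  define w where "w t = (if t \<in> {\<tau> 0..\<tau> (Suc k)} then z t else y (Suc k) t)" for t
  have step: "\<tau> (Suc k) < \<tau> (Suc (Suc k))"
    using Suc.prems(1) by simp
  have "(w has_vector_derivative F t (w t)) (at t within {\<tau> 0..\<tau> (Suc (Suc k))})"
    if "t \<in> {\<tau> 0..\<tau> (Suc (Suc k))}" for t
    unfolding w_def
  proof (rule has_vector_derivative_glue_Icc)
    show "\<tau> 0 \<le> \<tau> (Suc k)" "\<tau> (Suc k) \<le> \<tau> (Suc (Suc k))"
      using z(4) step by simp_all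
  qed (use that z Suc.prems in auto)
  moreover have "w (\<tau> 0) = y 0 (\<tau> 0)" "w (\<tau> (Suc (Suc k))) = y (Suc k) (\<tau> (Suc (Suc k)))"
      "\<tau> 0 < \<tau> (Suc (Suc k))"
    using z step by (auto simp: w_def)
  ultimately show ?case by blast
qed

text \<open>
  Adding a homogeneous solution to the solution of the boundary-value problem gives another
  solution, so uniqueness for one right-hand side already excludes nontrivial homogeneous solutions.
\<close>

lemma bvp_homogeneous_solution_zero:
  assumes "bvp_uniquely_solvable A r a b Ba Bb \<beta>"
    and z: "\<And>t. t \<in> {a..b} \<Longrightarrow> (z has_vector_derivative A t *v z t) (at t within {a..b})"
    and "Ba *v z a + Bb *v z b = 0" and "t \<in> {a..b}"
  shows "z t = 0"
proof -
  obtain x where x: "bvp_solution A r a b Ba Bb \<beta> x"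
      and unique: "\<And>y t. bvp_solution A r a b Ba Bb \<beta> y \<Longrightarrow> t \<in> {a..b} \<Longrightarrow> y t = x t"
    using assms(1) by (auto simp: bvp_uniquely_solvable_def)
  have "bvp_solution A r a b Ba Bb \<beta> (\<lambda>t. x t + z t)"
    unfolding bvp_solution_def
  proof (intro conjI ballI)
    fix t assume "t \<in> {a..b}"
    with x z[of t] show "((\<lambda>t. x t + z t) has_vector_derivative A t *v (x t + z t) + r t)
        (at t within {a..b})"
      by (auto simp: bvp_solution_def matrix_vector_right_distrib
          intro!: derivative_eq_intros)
  next
    have "Ba *v (x a + z a) + Bb *v (x b + z b) = \<beta> + (Ba *v z a + Bb *v z b)"
      using x by (auto simp: bvp_solution_def matrix_vector_right_distrib)
    then show "Ba *v (x a + z a) + Bb *v (x b + z b) = \<beta>"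
      using assms(3) by simp
  qed
  from unique[OF this \<open>t \<in> {a..b}\<close>] show ?thesis by simp
qed

section \<open>Block arithmetic\<close>

lemma block_pos_less: "block_pos (i :: 'm::{finite,linorder}) < CARD('m)"
  using bij_betw_block_pos[where 'm = 'm] by (auto simp: bij_betw_def)

lemma block_pos_surj:
  assumes "k < CARD('m::{finite,linorder})"
  obtains i :: "'m::{finite,linorder}" where "block_pos i = k"
  using assms bij_betw_imp_surj_on[OF bij_betw_block_pos[where 'm = 'm]]
  by (metis imageE lessThan_iff)

lemma sum_block_index:
  fixes g :: "nat \<Rightarrow> 'n::finite \<Rightarrow> 'b::comm_monoid_add"
  shows "(\<Sum>p\<in>(UNIV :: ('m::{finite,linorder} \<times> 'n) set). g (block_pos (fst p)) (snd p))
    = (\<Sum>j<CARD('m). \<Sum>l\<in>UNIV. g j l)"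
proof -
  have "(\<Sum>p\<in>(UNIV :: ('m \<times> 'n) set). g (block_pos (fst p)) (snd p))
      = (\<Sum>i\<in>(UNIV :: 'm set). \<Sum>l\<in>UNIV. g (block_pos i) l)"
    by (simp add: sum.cartesian_product case_prod_beta)
  also have "\<dots> = (\<Sum>j<CARD('m). \<Sum>l\<in>UNIV. g j l)"
    by (rule sum.reindex_bij_betw[OF bij_betw_block_pos])
  finally show ?thesis .
qed

lemma block_vector_cases:
  fixes c :: "real^('m::{finite,linorder} \<times> 'n::finite)"
  obtains f where "c = block_vector f"
proof
  have "inv block_pos (block_pos i) = i" for i :: 'm
    using bij_betw_block_pos[where 'm = 'm] by (simp add: bij_betw_def)
  then show "c = block_vector (\<lambda>j. \<chi> k. c $ (inv block_pos j, k))"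
    by (simp add: block_vector_def vec_eq_iff)
qed

lemma block_vector_eq_iff:
  "(block_vector f :: real^('m::{finite,linorder} \<times> 'n::finite)) = block_vector g
    \<longleftrightarrow> (\<forall>i<CARD('m). f i = g i)"
  by (auto simp: block_vector_def vec_eq_iff block_pos_less) (metis block_pos_surj)

lemma block_vector_0: "block_vector (\<lambda>_. 0) = 0"
  by (simp add: block_vector_def vec_eq_iff)

lemma block_vector_diff: "block_vector f - block_vector g = block_vector (\<lambda>i. f i - g i)"
  by (simp add: block_vector_def vec_eq_iff)

lemma block_matrix_mult_block_vector:
  "block_matrix F *v (block_vector f :: real^('m::{finite,linorder} \<times> 'n::finite))
    = block_vector (\<lambda>i. \<Sum>j<CARD('m). F i j *v f j)"
  by (simp add: vec_eq_iff block_matrix_def block_vector_def matrix_vector_mult_def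
      sum_block_index[where g = "\<lambda>j l. F i j $ k $ l * f j $ l" for i k])

lemma block_row_mult_block_vector:
  "block_row F *v (block_vector f :: real^('m::{finite,linorder} \<times> 'n::finite))
    = (\<Sum>j<CARD('m). F j *v f j)"
  by (simp add: vec_eq_iff block_row_def block_vector_def matrix_vector_mult_def
      sum_block_index[where g = "\<lambda>j l. F j $ k $ l * f j $ l" for k])

lemma block_column_mult: "block_column F *v d = block_vector (\<lambda>i. F i *v d)"
  by (simp add: vec_eq_iff block_column_def block_vector_def matrix_vector_mult_def)

section \<open>The multiple shooting matrices\<close>

lemma uminus_matrix_vector_mult: "(- P) *v x = - (P *v (x :: real^'n::finite))"
  by (simp add: vec_eq_iff matrix_vector_mult_def sum_negf)

lemma shooting_matrix_mult:
  assumes "2 \<le> CARD('m::{finite,linorder})"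
  shows "shooting_matrix Ba Bb X *v (block_vector f :: real^('m \<times> 'n::finite))
    = block_vector (\<lambda>i. if i < CARD('m) - 1 then f (Suc i) - X i *v f i
        else Ba *v f 0 + Bb *v (X (CARD('m) - 1) *v f (CARD('m) - 1)))"
proof -
  let ?m = "CARD('m)"
  let ?F = "\<lambda>i j. if i < ?m - 1
     then (if j = i then - X i else if j = i + 1 then mat 1 else 0)
     else (if j = 0 then Ba else if j = ?m - 1 then Bb ** X (?m - 1) else 0)"
  have cont: "(\<Sum>j<?m. ?F i j *v f j) = f (Suc i) - X i *v f i" if "i < ?m - 1" for i
  proof -
    have "?F i j *v f j = (if j = i then - (X i *v f i) else 0)
        + (if j = Suc i then f (Suc i) else 0)" for j
      using that by (simp add: uminus_matrix_vector_mult)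
    then show ?thesis
      using that less_diff_conv[of i ?m 1] by (simp add: sum.distrib)
  qed
  have bdry: "(\<Sum>j<?m. ?F i j *v f j) = Ba *v f 0 + Bb *v (X (?m - 1) *v f (?m - 1))"
    if "\<not> i < ?m - 1" for i
  proof -
    have "?F i j *v f j = (if j = 0 then Ba *v f 0 else 0)
        + (if j = ?m - 1 then Bb *v (X (?m - 1) *v f (?m - 1)) else 0)" for j
      using that assms by (simp add: matrix_vector_mul_assoc)
    then show ?thesis
      using assms by (simp add: sum.distrib)
  qed
  show ?thesis
    unfolding shooting_matrix_def block_matrix_mult_block_vector block_vector_eq_iff
  proof (intro allI impI)
    fix i
    show "(\<Sum>j<?m. ?F i j *v f j) = (if i < ?m - 1 then f (Suc i) - X i *v f i
        else Ba *v f 0 + Bb *v (X (?m - 1) *v f (?m - 1)))"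
    proof (cases "i < ?m - 1")
      case True
      from cont[OF this] show ?thesis by (simp only: True if_True)
    next
      case False
      from bdry[OF this] show ?thesis by (simp only: False if_False)
    qed
  qed
qed

lemma shooting_U_mult:
  "(shooting_U Ba :: real^'n^('m::{finite,linorder} \<times> 'n::finite)) *v d
    = block_vector (\<lambda>i. if i = CARD('m) - 1 then Ba *v d else 0)"
  unfolding shooting_U_def block_column_mult block_vector_eq_iff by simp

lemma shooting_V_mult:
  assumes "2 \<le> CARD('m::{finite,linorder})"
  shows "transpose (shooting_V L) *v (block_vector f :: real^('m \<times> 'n::finite))
    = f 0 - L *v f (CARD('m) - 1)"
proof -
  have "(if j = 0 then mat 1 else if j = CARD('m) - 1 then - L else 0) *v f j
      = (if j = 0 then f 0 else 0) + (if j = CARD('m) - 1 then - (L *v f (CARD('m) - 1)) else 0)"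
    for j
    using assms by (simp add: uminus_matrix_vector_mult)
  then show ?thesis
    using assms
    by (simp add: shooting_V_def transpose_transpose block_row_mult_block_vector sum.distrib
        del: transpose_matrix_vector)
qed

lemma matrix_inv:
  fixes P :: "'a::semiring_1^'n^'k"
  assumes "invertible P"
  shows "P ** matrix_inv P = mat 1" "matrix_inv P ** P = mat 1"
  using someI_ex[OF assms[unfolded invertible_def]] by (simp_all add: matrix_inv_def)

lemma inverse_product_mult:
  fixes X :: "nat \<Rightarrow> real^'n::finite^'n"
  assumes "\<And>i. i < k \<Longrightarrow> invertible (X i)" and "\<And>i. i < k \<Longrightarrow> f (Suc i) = X i *v f i"
  shows "inverse_product X k *v f k = f 0"
  using assms
proof (induction k)
  case (Suc k)
  then have "matrix_inv (X k) *v f (Suc k) = f k"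
    by (simp add: matrix_vector_mul_assoc matrix_inv)
  with Suc show ?case
    by (simp add: matrix_vector_mul_assoc[symmetric])
qed simp

text \<open>
  The key to the choice of \<open>L\<close>: the product of inverses carries the last block of a vector obeying
  the continuity recurrence back to its first block, and \<open>V\<^sup>T\<close> compares the two.
\<close>

lemma shooting_V_mult_eq_0:
  assumes "2 \<le> CARD('m::{finite,linorder})"
    and "\<And>i. i < CARD('m) - 1 \<Longrightarrow> invertible (X i)"
    and "\<And>i. i < CARD('m) - 1 \<Longrightarrow> f (Suc i) = X i *v f i"
  shows "transpose (shooting_V (inverse_product X (CARD('m) - 1)))
      *v (block_vector f :: real^('m \<times> 'n::finite)) = 0"
  using inverse_product_mult[of "CARD('m) - 1" X f] assms
  by (simp add: shooting_V_mult del: transpose_matrix_vector)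

text \<open>
  The range of \<open>U\<close> is confined to the last block, so neither the correction by \<open>U ** W\<close>, for any
  \<open>W\<close>, nor a right-hand side \<open>U d\<close> touches the continuity rows. The case \<open>d = 0\<close> serves the kernel
  of the reduced matrix, the general case serves the product \<open>V\<^sup>T M0\<inverse> U\<close>.
\<close>

lemma reduced_shooting_matrix_recurrence:
  fixes U :: "real^'n^('m::{finite,linorder} \<times> 'n::finite)"
  assumes "2 \<le> CARD('m)"
    and "(shooting_matrix Ba Bb X - shooting_U Ba ** W) *v (block_vector f :: real^('m \<times> 'n))
           = shooting_U Ba *v d"
    and "i < CARD('m) - 1"
  shows "f (Suc i) = X i *v f i"
proof -
  have "\<forall>i<CARD('m). (if i < CARD('m) - 1 then f (Suc i) - X i *v f i
        else Ba *v f 0 + Bb *v (X (CARD('m) - 1) *v f (CARD('m) - 1)))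
      - (if i = CARD('m) - 1 then Ba *v (W *v (block_vector f :: real^('m \<times> 'n))) else 0)
      = (if i = CARD('m) - 1 then Ba *v d else 0)"
    using assms(2) unfolding matrix_vector_mult_diff_rdistrib matrix_vector_mul_assoc[symmetric]
      shooting_matrix_mult[OF assms(1)] shooting_U_mult block_vector_diff block_vector_eq_iff .
  then show ?thesis
    using assms(3) by (auto dest: spec[of _ i])
qed

text \<open>
  The hypothesis \<open>trivial\<close> is the only place where the differential equation enters; it is the
  discrete form of the statement that the homogeneous boundary-value problem has only the zero
  solution.
\<close>

lemma invertible_reduced_shooting_matrix:
  fixes X :: "nat \<Rightarrow> real^'n::finite^'n" and Ba Bb :: "real^'n^'n"
  defines "S \<equiv> shooting_matrix Ba Bb X :: real^('m::{finite,linorder} \<times> 'n)^('m \<times> 'n)"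
    and "W \<equiv> transpose (shooting_V (inverse_product X (CARD('m) - 1)))"
  assumes card: "2 \<le> CARD('m)" and inv: "\<And>i. i < CARD('m) - 1 \<Longrightarrow> invertible (X i)"
    and trivial: "\<And>f. (\<And>i. i < CARD('m) - 1 \<Longrightarrow> f (Suc i) = X i *v f i) \<Longrightarrow>
        Ba *v f 0 + Bb *v (X (CARD('m) - 1) *v f (CARD('m) - 1)) = 0 \<Longrightarrow> f 0 = 0"
  shows "invertible (S - shooting_U Ba ** W)"
  unfolding invertible_iff_trivial_kernel
proof (intro allI impI)
  fix c assume c: "(S - shooting_U Ba ** W) *v c = 0"
  obtain f where f: "c = block_vector f" by (rule block_vector_cases)
  have rec: "f (Suc i) = X i *v f i" if "i < CARD('m) - 1" for i
    using reduced_shooting_matrix_recurrence[OF card _ that, of Ba Bb X W f 0] c f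
    by (simp add: S_def)
  have "W *v c = 0"
    unfolding W_def f using card inv rec by (rule shooting_V_mult_eq_0)
  with c have "S *v c = block_vector (\<lambda>_. 0)"
    by (simp add: matrix_vector_mult_diff_rdistrib matrix_vector_mul_assoc[symmetric]
        block_vector_0)
  then have "Ba *v f 0 + Bb *v (X (CARD('m) - 1) *v f (CARD('m) - 1)) = 0"
    unfolding S_def f shooting_matrix_mult[OF card] block_vector_eq_iff
    using card by (auto dest: spec[of _ "CARD('m) - 1"])
  with rec have "f 0 = 0" by (rule trivial)
  have "f i = 0" if "i < CARD('m)" for i
    using that by (induction i) (simp_all add: \<open>f 0 = 0\<close> rec)
  then show "c = 0"
    unfolding f block_vector_0[symmetric] block_vector_eq_iff by simp
qed

section \<open>The Sherman--Morrison--Woodbury formula with trivial capacitance matrix\<close>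

text \<open>
  When \<open>W P\<inverse> U = 0\<close>, the capacitance matrix \<open>1 + W P\<inverse> U\<close> of the Sherman-Morrison-Woodbury formula
  is the identity. Multiplying out \<open>(P + U W) (P\<inverse> - P\<inverse> U W P\<inverse>)\<close> then leaves the identity: the two
  first-order terms cancel and the second-order term contains the factor \<open>W P\<inverse> U\<close>.
\<close>

lemma woodbury_trivial_capacitance:
  fixes P :: "real^'l::finite^'l" and U :: "real^'p::finite^'l" and W :: "real^'l^'p"
  assumes "invertible P" and "W ** matrix_inv P ** U = 0"
  shows "invertible (P + U ** W)"
    and "(P + U ** W) *v x = y \<longleftrightarrow>
           x = matrix_inv P *v y - (matrix_inv P ** (U ** W) ** matrix_inv P) *v y"
proof -
  let ?D = "matrix_inv P"
  have PD: "P *v (?D *v z) = z" for z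
    by (simp add: matrix_vector_mul_assoc matrix_inv[OF assms(1)])
  have WDU: "W *v (?D *v (U *v z)) = 0" for z
    using assms(2) by (simp add: matrix_vector_mul_assoc matrix_mul_assoc)
  have right: "(P + U ** W) *v (?D *v y - (?D ** (U ** W) ** ?D) *v y) = y" for y
    by (simp add: matrix_vector_mult_add_rdistrib matrix_vector_mult_diff_distrib
        matrix_vector_mul_assoc[symmetric] PD WDU)
  then have "(P + U ** W) ** (?D - ?D ** (U ** W) ** ?D) = mat 1"
    unfolding matrix_eq by (simp add: matrix_vector_mul_assoc[symmetric]
        matrix_vector_mult_diff_rdistrib)
  then show inv: "invertible (P + U ** W)"
    by (auto simp: invertible_right_inverse)
  show "(P + U ** W) *v x = y \<longleftrightarrow> x = ?D *v y - (?D ** (U ** W) ** ?D) *v y"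
    using right[of y] matrix_inv(2)[OF inv]
    by (metis matrix_vector_mul_assoc matrix_vector_mul_lid)
qed

section \<open>Decoupled solution of the multiple shooting system\<close>

theorem mainTheorem1:
  fixes A :: "real \<Rightarrow> real^'n::finite^'n"
    and r :: "real \<Rightarrow> real^'n"
    and Ba Bb :: "real^'n^'n"
    and \<beta> :: "real^'n"
    and a b :: real
    and m :: nat
    and \<tau> :: "nat \<Rightarrow> real"
    and X :: "nat \<Rightarrow> real \<Rightarrow> real^'n^'n"
    and v :: "nat \<Rightarrow> real \<Rightarrow> real^'n"
    and X' :: "nat \<Rightarrow> real^'n^'n"
    and v' :: "nat \<Rightarrow> real^'n"
    and L :: "real^'n^'n"
    and M UV M0 :: "real^('m::{finite,linorder} \<times> 'n)^('m \<times> 'n)"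
    and U V :: "real^'n^('m \<times> 'n)"
    and q :: "real^('m \<times> 'n)"
  assumes "a < b"
    and "m = CARD('m)" and "m \<ge> 2"
    and "continuous_on {a..b} A" and "continuous_on {a..b} r"
    and "\<tau> 0 = a" and "\<tau> m = b" and "\<And>j. j < m \<Longrightarrow> \<tau> j < \<tau> (Suc j)"
    and "\<And>j. j < m \<Longrightarrow> X j (\<tau> j) = mat 1"
    and "\<And>j t. j < m \<Longrightarrow> t \<in> {\<tau> j..\<tau> (Suc j)} \<Longrightarrow>
           (X j has_vector_derivative A t ** X j t) (at t within {\<tau> j..\<tau> (Suc j)})"
    and "\<And>j. j < m \<Longrightarrow> v j (\<tau> j) = 0"
    and "\<And>j t. j < m \<Longrightarrow> t \<in> {\<tau> j..\<tau> (Suc j)} \<Longrightarrow>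
           (v j has_vector_derivative A t *v v j t + r t) (at t within {\<tau> j..\<tau> (Suc j)})"
    and "X' = (\<lambda>j. X j (\<tau> (Suc j)))"
    and "v' = (\<lambda>j. v j (\<tau> (Suc j)))"
    and "M = shooting_matrix Ba Bb X'"
    and "q = shooting_rhs Bb \<beta> v'"
    and "L = inverse_product X' (m - 1)"
    and "U = shooting_U Ba"
    and "V = shooting_V L"
    and "UV = U ** transpose V"
    and "M0 = M - UV"
    and "bvp_uniquely_solvable A r a b Ba Bb \<beta>"
  shows "invertible M0
    \<and> (transpose V ** matrix_inv M0 ** U = 0
       \<and> mat 1 + transpose V ** matrix_inv M0 ** U = mat 1
       \<and> invertible (mat 1 + transpose V ** matrix_inv M0 ** U))
    \<and> (invertible M
       \<and> (\<exists>!c. M *v c = q)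
       \<and> (\<forall>c. M *v c = q \<longrightarrow>
            c = matrix_inv M *v q
            \<and> c = matrix_inv M0 *v q - (matrix_inv M0 ** UV ** matrix_inv M0) *v q)
       \<and> (\<exists>!\<xi>. M0 *v \<xi> = q)
       \<and> (\<forall>\<xi>. M0 *v \<xi> = q \<longrightarrow> (\<exists>!\<zeta>. M0 *v \<zeta> = UV *v \<xi>))
       \<and> (\<forall>c \<xi> \<zeta>. M *v c = q \<longrightarrow> M0 *v \<xi> = q \<longrightarrow> M0 *v \<zeta> = UV *v \<xi> \<longrightarrow> c = \<xi> - \<zeta>))"
proof -
  have card: "2 \<le> CARD('m)" and m: "m = Suc (m - 1)"
    using assms(2,3) by auto
  have mono: "\<tau> i \<le> \<tau> j" if "i \<le> j" "j \<le> m" for i j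
    using that
  proof (induction j rule: dec_induct)
    case (step n)
    then show ?case using assms(8)[of n] by simp
  qed simp
  have inv: "invertible (X' j)" if "j < m" for j
    unfolding assms(13)
  proof (rule fundamental_matrix_invertible[where A = A and s = "\<tau> j"])
    have "{\<tau> j..\<tau> (Suc j)} \<subseteq> {a..b}"
      using mono[of 0 j] mono[of "Suc j" m] that assms(6,7) by auto
    then show "continuous_on {\<tau> j..\<tau> (Suc j)} A"
      using assms(4) continuous_on_subset by blast
  qed (use that assms in \<open>auto intro: less_imp_le\<close>)
  \<comment> \<open>The blocks \<open>f j\<close> are the initial values of the pieces \<open>X j t *v f j\<close> of a homogeneous
    solution; the recurrence makes the pieces match.\<close>
  have trivial: "f 0 = 0"
    if rec: "\<And>i. i < m - 1 \<Longrightarrow> f (Suc i) = X' i *v f i"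
      and bdry: "Ba *v f 0 + Bb *v (X' (m - 1) *v f (m - 1)) = 0" for f
  proof -
    have "\<exists>z. (\<forall>t\<in>{\<tau> 0..\<tau> (Suc (m - 1))}.
          (z has_vector_derivative A t *v z t) (at t within {\<tau> 0..\<tau> (Suc (m - 1))}))
        \<and> z (\<tau> 0) = X 0 (\<tau> 0) *v f 0
        \<and> z (\<tau> (Suc (m - 1))) = X (m - 1) (\<tau> (Suc (m - 1))) *v f (m - 1)
        \<and> \<tau> 0 < \<tau> (Suc (m - 1))"
    proof (rule glue_solutions[where y = "\<lambda>j t. X j t *v f j" and F = "\<lambda>t. (*v) (A t)"])
      fix j t assume "j \<le> m - 1" "t \<in> {\<tau> j..\<tau> (Suc j)}"
      then show "((\<lambda>t. X j t *v f j) has_vector_derivative A t *v (X j t *v f j))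
          (at t within {\<tau> j..\<tau> (Suc j)})"
        using m by (intro has_vector_derivative_matrix_solution_mult assms(10)) auto
    next
      fix j assume "j < m - 1"
      then show "X j (\<tau> (Suc j)) *v f j = X (Suc j) (\<tau> (Suc j)) *v f (Suc j)"
        using rec[of j] assms(9)[of "Suc j"] by (simp add: assms(13))
    qed (use m assms(8) in auto)
    then obtain z where z: "\<And>t. t \<in> {a..b} \<Longrightarrow>
          (z has_vector_derivative A t *v z t) (at t within {a..b})"
        "z a = f 0" "z b = X' (m - 1) *v f (m - 1)"
      using m assms(6,7,9,13) by (metis matrix_vector_mul_lid zero_less_Suc)
    have "z a = 0"
      using assms(22) z(1) by (rule bvp_homogeneous_solution_zero) (use z bdry assms(1) in auto)
    with z show ?thesis by simp
  qed
  have M0: "M0 = shooting_matrix Ba Bb X' - shooting_U Ba ** transpose (shooting_V L)"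
    using assms by simp
  have invM0: "invertible M0"
    unfolding M0 assms(17) assms(2)
    using card inv trivial by (intro invertible_reduced_shooting_matrix) (auto simp: assms(2))
  note inv0 = matrix_inv[OF invM0]
  have capacitance: "transpose V ** matrix_inv M0 ** U = 0"
    unfolding matrix_eq
  proof
    fix d
    obtain f where f: "matrix_inv M0 *v (U *v d) = block_vector f" by (rule block_vector_cases)
    have "M0 *v block_vector f = U *v d"
      unfolding f[symmetric] by (simp only: matrix_vector_mul_assoc[of M0] inv0 matrix_vector_mul_lid)
    \<comment> \<open>\<open>M0\<inverse> U d\<close> obeys the continuity recurrence, because \<open>U d\<close> vanishes outside the last block.\<close>
    then have "f (Suc i) = X' i *v f i" if "i < CARD('m) - 1" for i
      using reduced_shooting_matrix_recurrence[OF card _ that] M0 assms(18) by metis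
    then have "transpose V *v block_vector f = 0"
      unfolding assms(19,17,2) using card inv assms(2) by (intro shooting_V_mult_eq_0) auto
    then show "(transpose V ** matrix_inv M0 ** U) *v d = 0 *v d"
      by (simp add: matrix_vector_mul_assoc[symmetric] f del: transpose_matrix_vector)
  qed
  have M: "M = M0 + U ** transpose V"
    using assms(20,21) by simp
  note invM = woodbury_trivial_capacitance(1)[OF invM0 capacitance, folded M]
  note solM = woodbury_trivial_capacitance(2)[OF invM0 capacitance, folded M assms(20)]
  have solM0: "M0 *v x = y \<longleftrightarrow> x = matrix_inv M0 *v y" for x y
    using inv0 by (metis matrix_vector_mul_assoc matrix_vector_mul_lid)
  have solM': "M *v x = y \<longleftrightarrow> x = matrix_inv M *v y" for x y
    using matrix_inv[OF invM] by (metis matrix_vector_mul_assoc matrix_vector_mul_lid)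
  have "invertible (mat 1 :: real^'n^'n)"
    by (auto simp: invertible_def)
  moreover have "\<forall>c. M *v c = q \<longrightarrow> c = matrix_inv M *v q"
    using solM' by blast
  ultimately show ?thesis
    using invM0 capacitance invM
    by (simp add: solM solM0 matrix_vector_mul_assoc matrix_mul_assoc)
qed

end
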